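(* Let an entangled state have the Schmidt decomposition $|\mathrm{Ep}\rangle_{AB}=\sqrt{\gamma}\,|00\rangle_{AB}+\sqrt{1-\gamma}\,|11\rangle_{AB}$, where $\gamma\in(0,1)$. A product state orthogonal to it is characterized by two complex numbers $a$ and $b$ satisfying $$\left(|a|-\frac{\sqrt{\gamma}}{\sqrt{1-\gamma}}|b|\right)\left(|a|-\frac{\sqrt{1-\gamma}}{\sqrt{\gamma}}|b|\right)=1.$$ Its Schmidt decomposition (after normalizing the two single-qubit vectors) is expressed as $$|\mathrm{eP}\rangle_{AB}=\left(\sqrt{a}\,|0\rangle_A\mp i\sqrt{\frac{\sqrt{\gamma}}{\sqrt{1-\gamma}}}\sqrt{b}\,|1\rangle_A\right)\otimes\left(\pm i\sqrt{\frac{\sqrt{1-\gamma}}{\sqrt{\gamma}}}\sqrt{b}\,|0\rangle_B+\sqrt{a}\,|1\rangle_B\right).$$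
   Context: $|0\rangle,|1\rangle$ is the standard basis of $\mathbb{C}^2$ and $|jk\rangle_{AB}=|j\rangle_A\otimes|k\rangle_B$. A state is a unit vector; a state in $\mathbb{C}^2\otimes\mathbb{C}^2$ is a product state if it equals $|u\rangle\otimes|v\rangle$ for some $|u\rangle,|v\rangle\in\mathbb{C}^2$, and entangled otherwise. The signs $\mp$ and $\pm$ are taken both upper or both lower. The Schmidt decomposition of a product state is $|u\rangle\otimes|v\rangle$ with unit vectors $|u\rangle,|v\rangle$.
   Formalization: The printed constraint (minus signs) misses some orthogonal product states (e.g. γ=1/2, |a|=|b|); every such state is shown to arise with plus signs instead, and the states reached by the minus-sign constraint are determined exactly. *)

theory Defs
  imports "HOL-Analysis.Analysis"
begin

(* The index type 2 has exactly the two elements 0 and 1 (and 2 = 0 in it), so the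
   components of a qubit are u $ 0 and u $ 1.  A two-qubit vector is indexed by pairs. *)
type_synonym qubit = "complex ^ 2"
type_synonym two_qubit = "complex ^ (2 \<times> 2)"

definition ket :: "2 \<Rightarrow> qubit" where
  "ket j = axis j 1"

definition tensor :: "qubit \<Rightarrow> qubit \<Rightarrow> two_qubit" (infixl "\<otimes>\<^sub>q" 75) where
  "u \<otimes>\<^sub>q v = (\<chi> p. u $ fst p * v $ snd p)"

(* The Hermitian inner product; the library's \<bullet> on this type is only its real part. *)
definition braket :: "two_qubit \<Rightarrow> two_qubit \<Rightarrow> complex" where
  "braket \<phi> \<psi> = (\<Sum>p\<in>UNIV. cnj (\<phi> $ p) * \<psi> $ p)"

definition product_state :: "two_qubit \<Rightarrow> bool" where
  "product_state \<psi> \<longleftrightarrow> norm \<psi> = 1 \<and> (\<exists>u v. \<psi> = u \<otimes>\<^sub>q v)"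

definition entangled_state :: "two_qubit \<Rightarrow> bool" where
  "entangled_state \<psi> \<longleftrightarrow> norm \<psi> = 1 \<and> \<not> product_state \<psi>"

definition product_schmidt :: "two_qubit \<Rightarrow> qubit \<Rightarrow> qubit \<Rightarrow> bool" where
  "product_schmidt \<psi> u v \<longleftrightarrow> norm u = 1 \<and> norm v = 1 \<and> \<psi> = u \<otimes>\<^sub>q v"

definition Ep :: "real \<Rightarrow> two_qubit" where
  "Ep \<gamma> = complex_of_real (sqrt \<gamma>) *s (ket 0 \<otimes>\<^sub>q ket 0)
        + complex_of_real (sqrt (1 - \<gamma>)) *s (ket 1 \<otimes>\<^sub>q ket 1)"

(* The two factors before normalization.  The sign s is 1 for the upper and -1 for the lower
   choice in the two coupled signs; it is the same s in both factors.  Replacing a square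
   root csqrt a or csqrt b by its negative only multiplies each factor by a sign and possibly
   exchanges s and -s.  With r = sqrt \<gamma> / sqrt (1 - \<gamma>), the squared norms of the factors are
   cmod a + r * cmod b and cmod a + cmod b / r. *)
definition eP_A :: "real \<Rightarrow> complex \<Rightarrow> complex \<Rightarrow> complex \<Rightarrow> qubit" where
  "eP_A \<gamma> s a b = csqrt a *s ket 0
     + (- s * \<i> * complex_of_real (sqrt (sqrt \<gamma> / sqrt (1 - \<gamma>))) * csqrt b) *s ket 1"

definition eP_B :: "real \<Rightarrow> complex \<Rightarrow> complex \<Rightarrow> complex \<Rightarrow> qubit" where
  "eP_B \<gamma> s a b = (s * \<i> * complex_of_real (sqrt (sqrt (1 - \<gamma>) / sqrt \<gamma>)) * csqrt b) *s ket 0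
     + csqrt a *s ket 1"

lemma tensor_component: "(u \<otimes>\<^sub>q v) $ (j, k) = u $ j * v $ k"
  by (simp add: tensor_def)

lemma ket_component: "ket j $ k = (if k = j then 1 else 0)"
  by (auto simp: ket_def axis_def)

lemma UNIV_qubit: "(UNIV :: 2 set) = {0, 1}"
  using exhaust_2 by (auto simp: UNIV_2)

lemma UNIV_two_qubit: "(UNIV :: (2 \<times> 2) set) = {(0, 0), (0, 1), (1, 0), (1, 1)}"
  by (auto simp: UNIV_Times_UNIV [symmetric] UNIV_qubit simp del: UNIV_Times_UNIV)

lemma Ep_entangled:
  assumes "0 < \<gamma>" "\<gamma> < 1"
  shows "entangled_state (Ep \<gamma>)"
proof -
  have c: "Ep \<gamma> $ (0, 0) = complex_of_real (sqrt \<gamma>)" "Ep \<gamma> $ (0, 1) = 0" "Ep \<gamma> $ (1, 0) = 0"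
    "Ep \<gamma> $ (1, 1) = complex_of_real (sqrt (1 - \<gamma>))"
    by (simp_all add: Ep_def tensor_component ket_component)
  have "norm (Ep \<gamma>) = 1"
    using assms by (simp add: norm_vec_def L2_set_def UNIV_two_qubit c)
  moreover have False if "Ep \<gamma> = u \<otimes>\<^sub>q v" for u v
  proof -
    have "Ep \<gamma> $ (0, 0) * Ep \<gamma> $ (1, 1) = Ep \<gamma> $ (0, 1) * Ep \<gamma> $ (1, 0)"
      by (simp add: that tensor_component)
    then show False
      using assms by (simp add: c)
  qed
  ultimately show ?thesis
    by (auto simp: entangled_state_def product_state_def)
qed

end

(*
  For an amplitude matrix of rank one, psi_00 psi_11 = psi_01 psi_10.  Orthogonality to Ep says
  psi_11 = - r psi_00 with r = sqrt gamma / sqrt (1 - gamma), so r psi_00^2 = - psi_01 psi_10: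
  the off-diagonal amplitudes determine psi up to a sign s.  The vector eP_A \<otimes> eP_B has exactly
  the off-diagonal amplitudes a and b, hence psi = eP_A \<otimes> eP_B with a = psi_01, b = psi_10, and
  its squared norm is (|a| + r |b|) (|a| + |b| / r).  Scaling (a, b) by c > 0 leaves the normalized
  factors unchanged, so the equation with minus signs can be met exactly when its left-hand side
  is positive at (psi_01, psi_10).
*)

theory Submission
  imports Defs
begin

section \<open>Tensor products, normalization and positive scaling\<close>

lemma norm_tensor: "norm (u \<otimes>\<^sub>q v) = norm u * norm v"
  by (simp add: norm_vec_def L2_set_def UNIV_two_qubit UNIV_qubit tensor_component norm_mult
      power_mult_distrib algebra_simps flip: real_sqrt_mult)

lemma tensor_scaleR: "(c *\<^sub>R u) \<otimes>\<^sub>q (d *\<^sub>R v) = (c * d) *\<^sub>R (u \<otimes>\<^sub>q v)"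
  by (simp add: vec_eq_iff tensor_def)

lemma sgn_tensor: "sgn u \<otimes>\<^sub>q sgn v = sgn (u \<otimes>\<^sub>q v)"
  by (simp add: sgn_div_norm norm_tensor tensor_scaleR)

lemma tensor_eq_0_iff: "u \<otimes>\<^sub>q v = 0 \<longleftrightarrow> u = 0 \<or> v = 0"
  by (metis norm_tensor norm_eq_zero mult_eq_0_iff)

text \<open>\<open>sgn\<close> is multiplicative over the tensor product. The condition that the
  product is nonzero is what makes both normalized factors unit vectors, since
  \<open>sgn 0 = 0\<close>.\<close>

lemma product_schmidt_sgn:
  "product_schmidt \<psi> (sgn u) (sgn v) \<longleftrightarrow> u \<otimes>\<^sub>q v \<noteq> 0 \<and> \<psi> = sgn (u \<otimes>\<^sub>q v)"
  by (auto simp: product_schmidt_def sgn_tensor norm_sgn tensor_eq_0_iff)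

lemma two_qubit_eq_iff:
  fixes \<phi> \<psi> :: two_qubit
  shows "\<phi> = \<psi> \<longleftrightarrow> \<phi> $ (0, 0) = \<psi> $ (0, 0) \<and> \<phi> $ (0, 1) = \<psi> $ (0, 1) \<and>
    \<phi> $ (1, 0) = \<psi> $ (1, 0) \<and> \<phi> $ (1, 1) = \<psi> $ (1, 1)"
proof -
  have "\<phi> = \<psi> \<longleftrightarrow> (\<forall>p\<in>UNIV. \<phi> $ p = \<psi> $ p)"
    by (simp add: vec_eq_iff)
  then show ?thesis
    unfolding UNIV_two_qubit by simp
qed

lemma braket_Ep:
  "braket (Ep \<gamma>) \<psi> =
    complex_of_real (sqrt \<gamma>) * \<psi> $ (0, 0) + complex_of_real (sqrt (1 - \<gamma>)) * \<psi> $ (1, 1)"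
  by (simp add: braket_def UNIV_two_qubit Ep_def tensor_component ket_component)

lemma braket_scaleR_right: "braket \<phi> (c *\<^sub>R \<psi>) = c *\<^sub>R braket \<phi> \<psi>"
  by (simp add: braket_def scaleR_sum_right)

text \<open>Multiplication by a nonnegative real keeps a root in the region that singles out the
  principal branch. This makes both factors of the product vector homogeneous of degree 1/2 in the
  pair (a, b).\<close>

lemma csqrt_scaleR:
  assumes "0 \<le> c"
  shows "csqrt (c *\<^sub>R z) = sqrt c *\<^sub>R csqrt z"
proof (cases "c = 0")
  case False
  have "(sqrt c *\<^sub>R csqrt z)\<^sup>2 = c *\<^sub>R z"
    using assms by (simp add: scaleR_conv_of_real power_mult_distrib flip: of_real_power)
  moreover have "0 < Re (sqrt c *\<^sub>R csqrt z) \<or>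
      Re (sqrt c *\<^sub>R csqrt z) = 0 \<and> 0 \<le> Im (sqrt c *\<^sub>R csqrt z)"
    using csqrt_principal[of z] False assms by (auto simp: zero_less_mult_iff)
  ultimately show ?thesis
    by (rule csqrt_unique)
qed simp

lemma eP_A_scaleR: "0 \<le> c \<Longrightarrow> eP_A \<gamma> s (c *\<^sub>R a) (c *\<^sub>R b) = sqrt c *\<^sub>R eP_A \<gamma> s a b"
  by (simp add: eP_A_def csqrt_scaleR vec_eq_iff algebra_simps)

lemma eP_B_scaleR: "0 \<le> c \<Longrightarrow> eP_B \<gamma> s (c *\<^sub>R a) (c *\<^sub>R b) = sqrt c *\<^sub>R eP_B \<gamma> s a b"
  by (simp add: eP_B_def csqrt_scaleR vec_eq_iff algebra_simps)

section \<open>The product vector parametrized by (a, b) and the sign s\<close>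

context
  fixes \<gamma> :: real
  assumes \<gamma>: "0 < \<gamma>" "\<gamma> < 1"
begin

text \<open>The weights of the two factors are reciprocal and \<open>s * s = 1\<close>, so they
  cancel in the entry at (1, 0), where the two factors \<open>\<i>\<close> and the leading minus
  sign leave b.\<close>

lemma eP_tensor_components:
  assumes "s \<in> {1, -1}"
  defines "m \<equiv> sqrt \<gamma> / sqrt (1 - \<gamma>)"
  shows "(eP_A \<gamma> s a b \<otimes>\<^sub>q eP_B \<gamma> s a b) $ (0, 0) = s * \<i> * csqrt a * csqrt b / complex_of_real (sqrt m)"
    and "(eP_A \<gamma> s a b \<otimes>\<^sub>q eP_B \<gamma> s a b) $ (0, 1) = a"
    and "(eP_A \<gamma> s a b \<otimes>\<^sub>q eP_B \<gamma> s a b) $ (1, 0) = b"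
    and "(eP_A \<gamma> s a b \<otimes>\<^sub>q eP_B \<gamma> s a b) $ (1, 1) = - (s * \<i> * complex_of_real (sqrt m) * csqrt a * csqrt b)"
proof -
  have m: "0 < m" and inv: "sqrt (1 - \<gamma>) / sqrt \<gamma> = 1 / m"
    using \<gamma> by (auto simp: m_def)
  have "csqrt a * csqrt a = a" "csqrt b * csqrt b = b"
    by (metis power2_csqrt power2_eq_square)+
  then have "\<i> * (csqrt b * (\<i> * csqrt b)) = - b"
    by (simp add: mult.left_commute[of "csqrt b" \<i>])
  then show "(eP_A \<gamma> s a b \<otimes>\<^sub>q eP_B \<gamma> s a b) $ (0, 0) = s * \<i> * csqrt a * csqrt b / complex_of_real (sqrt m)"
    "(eP_A \<gamma> s a b \<otimes>\<^sub>q eP_B \<gamma> s a b) $ (0, 1) = a"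
    "(eP_A \<gamma> s a b \<otimes>\<^sub>q eP_B \<gamma> s a b) $ (1, 0) = b"
    "(eP_A \<gamma> s a b \<otimes>\<^sub>q eP_B \<gamma> s a b) $ (1, 1) = - (s * \<i> * complex_of_real (sqrt m) * csqrt a * csqrt b)"
    using m assms(1) \<open>csqrt a * csqrt a = a\<close>
    by (auto simp: tensor_component eP_A_def eP_B_def ket_component inv real_sqrt_divide
        simp flip: m_def)
qed

text \<open>The entry at (1, 1) is \<open>- sqrt \<gamma> / sqrt (1 - \<gamma>)\<close> times the
  entry at (0, 0), so the two terms of the inner product cancel.\<close>

lemma braket_Ep_eP:
  assumes "s \<in> {1, -1}"
  shows "braket (Ep \<gamma>) (eP_A \<gamma> s a b \<otimes>\<^sub>q eP_B \<gamma> s a b) = 0"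
proof -
  define m where "m = sqrt \<gamma> / sqrt (1 - \<gamma>)"
  have "0 < m" "sqrt \<gamma> = sqrt m * sqrt m * sqrt (1 - \<gamma>)"
    using \<gamma> by (auto simp: m_def)
  then have "complex_of_real (sqrt m) \<noteq> 0" "complex_of_real (sqrt \<gamma>) =
      complex_of_real (sqrt m) * complex_of_real (sqrt m) * complex_of_real (sqrt (1 - \<gamma>))"
    by (simp_all only: of_real_mult) simp
  then show ?thesis
    by (simp add: braket_Ep eP_tensor_components[OF assms] flip: m_def)
qed

lemma eP_tensor_eq_0_iff:
  assumes "s \<in> {1, -1}"
  shows "eP_A \<gamma> s a b \<otimes>\<^sub>q eP_B \<gamma> s a b = 0 \<longleftrightarrow> a = 0 \<and> b = 0"
  by (auto simp: two_qubit_eq_iff eP_tensor_components[OF assms])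

text \<open>This identifies the equation with plus signs as the normalization of the product
  vector.\<close>

lemma norm_eP_tensor:
  assumes "s \<in> {1, -1}"
  shows "(norm (eP_A \<gamma> s a b \<otimes>\<^sub>q eP_B \<gamma> s a b))\<^sup>2 =
    (cmod a + sqrt \<gamma> / sqrt (1 - \<gamma>) * cmod b) * (cmod a + sqrt (1 - \<gamma>) / sqrt \<gamma> * cmod b)"
proof -
  have s: "cmod s = 1" using assms by auto
  have "(norm (eP_A \<gamma> s a b))\<^sup>2 = cmod a + sqrt \<gamma> / sqrt (1 - \<gamma>) * cmod b"
    "(norm (eP_B \<gamma> s a b))\<^sup>2 = cmod a + sqrt (1 - \<gamma>) / sqrt \<gamma> * cmod b"
    using \<gamma> s by (simp_all add: norm_vec_def L2_set_def UNIV_qubit eP_A_def eP_B_def ket_component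
        norm_mult power_mult_distrib norm_power)
  then show ?thesis
    by (simp add: norm_tensor power_mult_distrib)
qed

lemma orthogonal_product_eq_eP:
  assumes "product_state \<psi>" "braket (Ep \<gamma>) \<psi> = 0"
  obtains s where "s \<in> {1, -1}"
    "\<psi> = eP_A \<gamma> s (\<psi> $ (0, 1)) (\<psi> $ (1, 0)) \<otimes>\<^sub>q eP_B \<gamma> s (\<psi> $ (0, 1)) (\<psi> $ (1, 0))"
proof -
  define m where "m = sqrt \<gamma> / sqrt (1 - \<gamma>)"
  \<comment> \<open>\<open>h\<close> is the weight inside \<open>eP_A\<close>; as a square root of
    \<open>m\<close> it will turn the rank-one relation into an equality of two squares.\<close>
  define h where "h = complex_of_real (sqrt m)"
  have m: "0 < m" "sqrt \<gamma> = m * sqrt (1 - \<gamma>)" and "sqrt (1 - \<gamma>) \<noteq> 0"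
    using \<gamma> by (auto simp: m_def)
  have h: "h \<noteq> 0" "h * h = complex_of_real m"
    using m(1) by (auto simp: h_def simp flip: of_real_mult)
  define x y p q where "x = \<psi> $ (0, 1)" "y = \<psi> $ (1, 0)" "p = \<psi> $ (0, 0)" "q = \<psi> $ (1, 1)"
  note defs = this
  have "complex_of_real (sqrt (1 - \<gamma>)) * (h * h * p + q) = 0"
    using assms(2) by (simp add: braket_Ep defs h(2) m(2) algebra_simps)
  then have q: "q = - (h * h * p)"
    using \<open>sqrt (1 - \<gamma>) \<noteq> 0\<close> by (simp add: add_eq_0_iff)
  \<comment> \<open>The amplitude matrix of a product vector has determinant zero.\<close>
  have "p * q = x * y"
    using assms(1) by (auto simp: product_state_def defs tensor_component)
  then have "(h * p)\<^sup>2 = (\<i> * csqrt x * csqrt y)\<^sup>2"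
    by (simp add: q power_mult_distrib) (simp add: power2_eq_square algebra_simps minus_equation_iff)
  \<comment> \<open>The two square roots correspond to the two values of s.\<close>
  then have "h * p = \<i> * csqrt x * csqrt y \<or> h * p = - (\<i> * csqrt x * csqrt y)"
    by (simp only: power2_eq_iff)
  then obtain s where s: "s \<in> {1, -1}" and "h * p = s * \<i> * csqrt x * csqrt y"
    by (metis insert_iff mult_1 mult_minus1 mult.assoc)
  then have hp: "p = s * \<i> * csqrt x * csqrt y / h"
    using h(1) by (simp add: field_simps)
  have "q = - (s * \<i> * h * csqrt x * csqrt y)"
    using h(1) by (simp add: q hp)
  with hp have "\<psi> = eP_A \<gamma> s x y \<otimes>\<^sub>q eP_B \<gamma> s x y"
    unfolding two_qubit_eq_iff eP_tensor_components[OF s]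
    by (simp add: h_def m_def defs)
  then show thesis
    using that s by (simp add: defs)
qed

end

text \<open>The equation with plus signs expresses normalization and is therefore available for
  every orthogonal product state. The equation with minus signs reaches only some of these states,
  and the last clause tells which.\<close>

theorem proposition6:
  fixes \<gamma> :: real and E :: two_qubit
  assumes "0 < \<gamma>" and "\<gamma> < 1"
    and "entangled_state E" and "E = Ep \<gamma>"
  shows
    "(\<forall>a b s. s \<in> {1, -1} \<longrightarrow>
        (cmod a - sqrt \<gamma> / sqrt (1 - \<gamma>) * cmod b) * (cmod a - sqrt (1 - \<gamma>) / sqrt \<gamma> * cmod b) = 1 \<or>
        (cmod a + sqrt \<gamma> / sqrt (1 - \<gamma>) * cmod b) * (cmod a + sqrt (1 - \<gamma>) / sqrt \<gamma> * cmod b) = 1 \<longrightarrow>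
        (\<exists>\<psi>. product_state \<psi> \<and> braket E \<psi> = 0 \<and>
             product_schmidt \<psi> (sgn (eP_A \<gamma> s a b)) (sgn (eP_B \<gamma> s a b))))
     \<and>
     (\<forall>\<psi>. product_state \<psi> \<and> braket E \<psi> = 0 \<longrightarrow>
        (\<exists>a b s. s \<in> {1, -1} \<and>
           (cmod a + sqrt \<gamma> / sqrt (1 - \<gamma>) * cmod b) * (cmod a + sqrt (1 - \<gamma>) / sqrt \<gamma> * cmod b) = 1 \<and>
           product_schmidt \<psi> (sgn (eP_A \<gamma> s a b)) (sgn (eP_B \<gamma> s a b))))
     \<and>
     (\<forall>\<psi>. product_state \<psi> \<and> braket E \<psi> = 0 \<longrightarrow>
        ((\<exists>a b s. s \<in> {1, -1} \<and>
           (cmod a - sqrt \<gamma> / sqrt (1 - \<gamma>) * cmod b) * (cmod a - sqrt (1 - \<gamma>) / sqrt \<gamma> * cmod b) = 1 \<and>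
           product_schmidt \<psi> (sgn (eP_A \<gamma> s a b)) (sgn (eP_B \<gamma> s a b)))
         \<longleftrightarrow>
         (cmod (\<psi> $ (0, 1)) - sqrt \<gamma> / sqrt (1 - \<gamma>) * cmod (\<psi> $ (1, 0))) *
         (cmod (\<psi> $ (0, 1)) - sqrt (1 - \<gamma>) / sqrt \<gamma> * cmod (\<psi> $ (1, 0))) > 0))"
proof (intro conjI allI impI; (elim conjE)?)
  note \<gamma> = assms(1,2)
  fix a b s :: complex
  assume s: "s \<in> {1, -1}"
    and ab: "(cmod a - sqrt \<gamma> / sqrt (1 - \<gamma>) * cmod b) * (cmod a - sqrt (1 - \<gamma>) / sqrt \<gamma> * cmod b) = 1 \<or>
      (cmod a + sqrt \<gamma> / sqrt (1 - \<gamma>) * cmod b) * (cmod a + sqrt (1 - \<gamma>) / sqrt \<gamma> * cmod b) = 1"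
  define T where "T = eP_A \<gamma> s a b \<otimes>\<^sub>q eP_B \<gamma> s a b"
  \<comment> \<open>Both left-hand sides vanish at a = b = 0, and \<open>T\<close> vanishes only
    there because its off-diagonal entries are a and b.\<close>
  have "T \<noteq> 0"
    using ab by (auto simp: T_def eP_tensor_eq_0_iff[OF \<gamma> s])
  then have "product_schmidt (sgn T) (sgn (eP_A \<gamma> s a b)) (sgn (eP_B \<gamma> s a b))"
    by (simp add: product_schmidt_sgn T_def)
  moreover from \<open>T \<noteq> 0\<close> have "product_state (sgn T)"
    by (auto simp: product_state_def norm_sgn T_def intro: sgn_tensor[symmetric])
  moreover have "braket E (sgn T) = 0"
    using braket_Ep_eP[OF \<gamma> s, of a b]
    by (simp add: \<open>E = Ep \<gamma>\<close> T_def sgn_div_norm braket_scaleR_right)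
  ultimately show "\<exists>\<psi>. product_state \<psi> \<and> braket E \<psi> = 0 \<and>
      product_schmidt \<psi> (sgn (eP_A \<gamma> s a b)) (sgn (eP_B \<gamma> s a b))"
    by blast
next
  note \<gamma> = assms(1,2)
  fix \<psi>
  assume \<psi>: "product_state \<psi>" "braket E \<psi> = 0"
  define a b where "a = \<psi> $ (0, 1)" and "b = \<psi> $ (1, 0)"
  obtain s where s: "s \<in> {1, -1}" and eq: "\<psi> = eP_A \<gamma> s a b \<otimes>\<^sub>q eP_B \<gamma> s a b"
    using orthogonal_product_eq_eP[OF \<gamma> \<psi>(1)] \<psi>(2) \<open>E = Ep \<gamma>\<close> unfolding a_def b_def by blast
  have "norm \<psi> = 1"
    using \<psi>(1) by (simp add: product_state_def)
  \<comment> \<open>The product vector is already the unit vector \<open>\<psi>\<close>, so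
    normalizing each factor leaves their tensor product unchanged.\<close>
  then have "product_schmidt \<psi> (sgn (eP_A \<gamma> s a b)) (sgn (eP_B \<gamma> s a b))"
    unfolding product_schmidt_sgn eq[symmetric] by (auto simp: sgn_div_norm)
  moreover have
    "(cmod a + sqrt \<gamma> / sqrt (1 - \<gamma>) * cmod b) * (cmod a + sqrt (1 - \<gamma>) / sqrt \<gamma> * cmod b) = 1"
    using norm_eP_tensor[OF \<gamma> s, of a b] \<open>norm \<psi> = 1\<close> unfolding eq[symmetric] by simp
  ultimately show "\<exists>a b s. s \<in> {1, -1} \<and>
      (cmod a + sqrt \<gamma> / sqrt (1 - \<gamma>) * cmod b) * (cmod a + sqrt (1 - \<gamma>) / sqrt \<gamma> * cmod b) = 1 \<and>
      product_schmidt \<psi> (sgn (eP_A \<gamma> s a b)) (sgn (eP_B \<gamma> s a b))"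
    using s by blast
next
  note \<gamma> = assms(1,2)
  fix \<psi>
  assume \<psi>: "product_state \<psi>" "braket E \<psi> = 0"
  define Q where "Q a b = (cmod a - sqrt \<gamma> / sqrt (1 - \<gamma>) * cmod b) *
    (cmod a - sqrt (1 - \<gamma>) / sqrt \<gamma> * cmod b)" for a b
  \<comment> \<open>Homogeneity of degree two: the sign of \<open>Q\<close> is constant along each
    positive ray.\<close>
  have Q_scaleR: "Q (c *\<^sub>R a) (c *\<^sub>R b) = c\<^sup>2 * Q a b" if "0 \<le> c" for c a b
    using that by (simp add: Q_def power2_eq_square algebra_simps)
  define x y where "x = \<psi> $ (0, 1)" and "y = \<psi> $ (1, 0)"
  have "(\<exists>a b s. s \<in> {1, -1} \<and> Q a b = 1 \<and>
      product_schmidt \<psi> (sgn (eP_A \<gamma> s a b)) (sgn (eP_B \<gamma> s a b))) \<longleftrightarrow> Q x y > 0"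
  proof
    assume "\<exists>a b s. s \<in> {1, -1} \<and> Q a b = 1 \<and>
      product_schmidt \<psi> (sgn (eP_A \<gamma> s a b)) (sgn (eP_B \<gamma> s a b))"
    then obtain a b s where s: "s \<in> {1, -1}" and "Q a b = 1"
      and "product_schmidt \<psi> (sgn (eP_A \<gamma> s a b)) (sgn (eP_B \<gamma> s a b))"
      by blast
    define T where "T = eP_A \<gamma> s a b \<otimes>\<^sub>q eP_B \<gamma> s a b"
    have "T \<noteq> 0" "\<psi> = sgn T"
      using \<open>product_schmidt \<psi> _ _\<close> by (simp_all add: product_schmidt_sgn T_def)
    \<comment> \<open>The off-diagonal entries of \<open>T\<close> are a and b, so (x, y) lies on
      the positive ray through (a, b), where \<open>Q\<close> stays positive.\<close>
    then have "x = inverse (norm T) *\<^sub>R a" "y = inverse (norm T) *\<^sub>R b"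
      using eP_tensor_components(2,3)[OF \<gamma> s, of a b]
      by (simp_all add: x_def y_def sgn_div_norm T_def)
    with Q_scaleR[of "inverse (norm T)" a b] \<open>T \<noteq> 0\<close> \<open>Q a b = 1\<close> show "Q x y > 0"
      by simp
  next
    assume "Q x y > 0"
    \<comment> \<open>This is the scale at which the quadratic expression \<open>Q\<close> takes the
      value 1.\<close>
    define c where "c = inverse (sqrt (Q x y))"
    have c: "0 < c" "c\<^sup>2 * Q x y = 1"
      using \<open>Q x y > 0\<close> by (simp_all add: c_def power_inverse)
    obtain s where s: "s \<in> {1, -1}" and eq: "\<psi> = eP_A \<gamma> s x y \<otimes>\<^sub>q eP_B \<gamma> s x y"
      using orthogonal_product_eq_eP[OF \<gamma> \<psi>(1)] \<psi>(2) \<open>E = Ep \<gamma>\<close> unfolding x_def y_def by blast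
    \<comment> \<open>Each factor contributes \<open>sqrt c\<close>, so the tensor product is scaled
      by c and its normalization is still \<open>\<psi>\<close>.\<close>
    have "eP_A \<gamma> s (c *\<^sub>R x) (c *\<^sub>R y) \<otimes>\<^sub>q eP_B \<gamma> s (c *\<^sub>R x) (c *\<^sub>R y) = c *\<^sub>R \<psi>"
      using c(1) by (simp add: eP_A_scaleR eP_B_scaleR tensor_scaleR flip: eq)
    moreover have "norm \<psi> = 1"
      using \<psi>(1) by (simp add: product_state_def)
    then have "c *\<^sub>R \<psi> \<noteq> 0" "sgn (c *\<^sub>R \<psi>) = \<psi>"
      using c(1) by (auto simp: sgn_div_norm)
    ultimately have "product_schmidt \<psi> (sgn (eP_A \<gamma> s (c *\<^sub>R x) (c *\<^sub>R y)))
        (sgn (eP_B \<gamma> s (c *\<^sub>R x) (c *\<^sub>R y)))"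
      by (simp add: product_schmidt_sgn)
    moreover have "Q (c *\<^sub>R x) (c *\<^sub>R y) = 1"
      using Q_scaleR[of c x y] c by simp
    ultimately show "\<exists>a b s. s \<in> {1, -1} \<and> Q a b = 1 \<and>
        product_schmidt \<psi> (sgn (eP_A \<gamma> s a b)) (sgn (eP_B \<gamma> s a b))"
      using s by blast
  qed
  then show "(\<exists>a b s. s \<in> {1, -1} \<and>
        (cmod a - sqrt \<gamma> / sqrt (1 - \<gamma>) * cmod b) * (cmod a - sqrt (1 - \<gamma>) / sqrt \<gamma> * cmod b) = 1 \<and>
        product_schmidt \<psi> (sgn (eP_A \<gamma> s a b)) (sgn (eP_B \<gamma> s a b))) \<longleftrightarrow>
      (cmod (\<psi> $ (0, 1)) - sqrt \<gamma> / sqrt (1 - \<gamma>) * cmod (\<psi> $ (1, 0))) *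
      (cmod (\<psi> $ (0, 1)) - sqrt (1 - \<gamma>) / sqrt \<gamma> * cmod (\<psi> $ (1, 0))) > 0"
    unfolding Q_def x_def y_def .
qed

end
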